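(* Let $P\in\mathcal{A}$, i.e. let $P$ be a convex polytope with nine vertices, all on $\mathbb{S}^2$, of the combinatorial type of the apex-split hexagonal bipyramid. Then $$6\operatorname{vol}(P)<9\sqrt{\frac65}+\frac{\sqrt{91}}{4}.$$
   Context: $\mathbb{S}^2$ is the unit sphere in $\mathbb{R}^3$ and $\operatorname{vol}$ is 3-dimensional volume. Two polytopes are combinatorially equivalent if there is an inclusion-preserving bijection between their sets of faces. $\mathcal{A}$ is the class of convex polytopes with nine vertices inscribed in $\mathbb{S}^2$ having the combinatorial type of the apex-split hexagonal bipyramid, i.e. the simplicial type with vertices $p_1,\dots,p_9$ and exactly the following 14 triangular facets: $[p_9,p_1,p_2]$, $[p_9,p_2,p_6]$, $[p_9,p_6,p_3]$, $[p_9,p_3,p_4]$, $[p_9,p_4,p_5]$, $[p_9,p_5,p_1]$, $[p_7,p_3,p_6]$, $[p_7,p_4,p_3]$, $[p_7,p_5,p_4]$, $[p_8,p_1,p_5]$, $[p_8,p_2,p_1]$, $[p_8,p_6,p_2]$, $[p_7,p_8,p_5]$, $[p_7,p_6,p_8]$. *)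

theory Defs
  imports "HOL-Analysis.Analysis"
begin

definition vertices_of :: "'a::real_vector set \<Rightarrow> 'a set" where
  "vertices_of P = {x. x extreme_point_of P}"

(* The faces in the sense of face_of include the empty face and P itself.  A bijection is
   inclusion-preserving when inclusions are preserved in both directions, i.e. it is an
   isomorphism of the face lattices. *)
definition combinatorially_equivalent ::
    "'a::real_vector set \<Rightarrow> 'b::real_vector set \<Rightarrow> bool" where
  "combinatorially_equivalent P Q \<longleftrightarrow>
     (\<exists>\<phi>. bij_betw \<phi> {F. F face_of P} {G. G face_of Q} \<and>
          (\<forall>F F'. F face_of P \<longrightarrow> F' face_of P \<longrightarrow> (F \<subseteq> F' \<longleftrightarrow> \<phi> F \<subseteq> \<phi> F')))"

definition apex_split_triangles :: "nat set set" where
  "apex_split_triangles =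
     {{9,1,2}, {9,2,6}, {9,6,3}, {9,3,4}, {9,4,5}, {9,5,1},
      {7,3,6}, {7,4,3}, {7,5,4},
      {8,1,5}, {8,2,1}, {8,6,2},
      {7,8,5}, {7,6,8}}"

(* Q is a polytope with vertices p 1, ..., p 9 whose facets are exactly the 14 triangles
   listed above. *)
definition apex_split_hexagonal_bipyramid :: "(real^3) set \<Rightarrow> bool" where
  "apex_split_hexagonal_bipyramid Q \<longleftrightarrow>
     polytope Q \<and>
     (\<exists>p :: nat \<Rightarrow> real^3.
        bij_betw p {1..9} (vertices_of Q) \<and>
        {F. F facet_of Q} = (\<lambda>t. convex hull (p ` t)) ` apex_split_triangles)"

definition class_A :: "(real^3) set set" where
  "class_A =
     {P. polytope P \<and> card (vertices_of P) = 9 \<and> vertices_of P \<subseteq> sphere 0 1 \<and>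
         (\<exists>Q. apex_split_hexagonal_bipyramid Q \<and> combinatorially_equivalent P Q)}"

end

theory Submission
  imports Defs
begin

text \<open>
  Coherent orientation of adjacent facets gives \<open>6 vol P = \<bar>S\<bar>\<close>, where \<open>S\<close> is the sum of
  the 14 determinants of the facets; only \<open>\<le>\<close> is needed, and it follows by covering \<open>P\<close> with
  the cones over its facets from an interior point. It remains to bound \<open>S\<close> for arbitrary unit
  vectors. With \<open>u = p\<^sub>9 - p\<^sub>8\<close> and \<open>v = p\<^sub>9 - p\<^sub>7\<close>,
  \<open>S = u \<bullet> (p\<^sub>5 \<times> p\<^sub>1 + p\<^sub>1 \<times> p\<^sub>2 + p\<^sub>2 \<times> p\<^sub>6) + v \<bullet> (p\<^sub>6 \<times> p\<^sub>3 + p\<^sub>3 \<times> p\<^sub>4 + p\<^sub>4 \<times> p\<^sub>5)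
  + (p\<^sub>7 \<times> p\<^sub>8) \<bullet> (p\<^sub>5 - p\<^sub>6)\<close>.
  The vertices \<open>p\<^sub>1\<close>, ..., \<open>p\<^sub>4\<close> are eliminated by a Lagrangian bound on the two paths, with the
  multiplier \<open>\<surd>3 / 2\<close> that is exact for the regular hexagon. What is left involves
  only \<open>p\<^sub>5\<close>, ..., \<open>p\<^sub>9\<close> and is at most about 12.07 < 12.24.
\<close>

unbundle cross3_syntax

section \<open>The sum of determinants for points on the sphere\<close>

text \<open>The difference of the two sides is a quadratic form in \<open>x\<close>,
  \<open>y\<close> once \<open>n\<close>, \<open>a\<close>, \<open>b\<close> are fixed, so
  completing squares removes first \<open>x\<close>, then \<open>y\<close>. Equality holds when
  \<open>a\<close>, \<open>x\<close>, \<open>y\<close>, \<open>b\<close> are consecutive vertices of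
  a regular hexagon with positively oriented unit normal \<open>n\<close>.\<close>

lemma cross_path_bound:
  fixes n a x y b :: "real^3"
  assumes n: "norm n = 1"
  defines "l \<equiv> sqrt 3 / 2"
  shows "n \<bullet> (a \<times> x + x \<times> y + y \<times> b)
    \<le> l * ((norm x)\<^sup>2 + (norm y)\<^sup>2) + (l * ((norm a)\<^sup>2 + (norm b)\<^sup>2) - n \<bullet> (a \<times> b)) / 2"
proof -
  \<comment> \<open>The shift by half of \<open>a\<close> is chosen so that the multiples of
    \<open>a \<bullet> y\<close> from \<open>4\<close> and \<open>5\<close> cancel in the final
    sum.\<close>
  define w where "w = y + (1/2) *\<^sub>R a"
  have l: "l > 0" "l * l = 3/4" by (simp_all add: l_def)
  have contr: "norm (n \<times> z) \<le> norm z" for z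
    using norm_cross_dot[of n z] n
    by (metis abs_ge_zero abs_le_square_iff abs_norm_cancel le_add_same_cancel1 mult_1 zero_le_power2)
  \<comment> \<open>The square vanishes at the \<open>x\<close> that maximizes the left side minus
    \<open>l * (norm x)\<^sup>2\<close>.\<close>
  have "0 \<le> (norm ((2 * l) *\<^sub>R x - n \<times> (a - y)))\<^sup>2"
    by simp
  also have "\<dots> = (2 * l)\<^sup>2 * (norm x)\<^sup>2 - 4 * l * (x \<bullet> (n \<times> (a - y))) + (norm (n \<times> (a - y)))\<^sup>2"
    unfolding power2_norm_eq_inner
    by (simp add: inner_diff inner_commute power2_eq_square algebra_simps)
  also have "(2 * l)\<^sup>2 = 3" using l by (simp add: power2_eq_square)
  also have "x \<bullet> (n \<times> (a - y)) = n \<bullet> (a \<times> x + x \<times> y)"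
    by (simp add: cross3_simps)
  also have "(norm (n \<times> (a - y)))\<^sup>2 \<le> (norm (a - y))\<^sup>2"
    using contr by (simp add: power_mono)
  finally have "4 * l * (n \<bullet> (a \<times> x + x \<times> y)) \<le> 3 * (norm x)\<^sup>2 + (norm (a - y))\<^sup>2"
    by simp
  then have "l * (4 * l * (n \<bullet> (a \<times> x + x \<times> y))) \<le> l * (3 * (norm x)\<^sup>2 + (norm (a - y))\<^sup>2)"
    using l by (intro mult_left_mono) auto
  also have "l * (4 * l * (n \<bullet> (a \<times> x + x \<times> y))) = 4 * (l * l) * (n \<bullet> (a \<times> x + x \<times> y))"
    by simp
  finally have 1: "n \<bullet> (a \<times> x + x \<times> y) \<le> l * (norm x)\<^sup>2 + l / 3 * (norm (a - y))\<^sup>2"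
    using l by (simp add: algebra_simps)
  have "n \<bullet> (w \<times> b) \<le> norm n * norm (w \<times> b)"
    by (rule norm_cauchy_schwarz)
  also have "\<dots> \<le> norm w * norm b"
    using norm_cross_dot[of w b] n
    by (metis abs_ge_zero abs_le_square_iff abs_norm_cancel abs_mult le_add_same_cancel1 mult_1 zero_le_power2)
  finally have 2: "n \<bullet> (w \<times> b) \<le> norm w * norm b" .
  \<comment> \<open>AM-GM weighted for the hexagon, where \<open>norm w = l\<close> and
    \<open>norm b = 1\<close>.\<close>
  have "0 \<le> (l / 6) * (2 * norm w - 2 * l * norm b)\<^sup>2" using l by simp
  also have "\<dots> = l * (2/3) * (norm w)\<^sup>2 - 4/3 * (l * l) * (norm w * norm b) + 2/3 * (l * l) * l * (norm b)\<^sup>2"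
    by (simp add: power2_eq_square algebra_simps)
  finally have 3: "norm w * norm b \<le> 2 * l / 3 * (norm w)\<^sup>2 + l / 2 * (norm b)\<^sup>2"
    using l by simp
  have 4: "(norm w)\<^sup>2 = (norm y)\<^sup>2 + a \<bullet> y + (norm a)\<^sup>2 / 4"
    unfolding power2_norm_eq_inner w_def by (simp add: inner_add inner_commute)
  have 5: "(norm (a - y))\<^sup>2 = (norm y)\<^sup>2 - 2 * (a \<bullet> y) + (norm a)\<^sup>2"
    unfolding power2_norm_eq_inner w_def by (simp add: inner_diff inner_commute)
  have 6: "n \<bullet> (w \<times> b) = n \<bullet> (y \<times> b) + n \<bullet> (a \<times> b) / 2"
    by (simp add: w_def cross_add_left cross_mult_left inner_add)
  show ?thesis
    using 1 2 3 unfolding 4 5 6 inner_add ring_distribs by argo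
qed

text \<open>Tangent bounds at \<open>c = 4/5\<close>, \<open>s = 3/5\<close>, which is close to the maximum; the first square
  root is there exactly \<open>9 \<surd>(6/5)\<close>, for which the proof takes 9.86.\<close>
lemma univariate_bound:
  fixes c s :: real
  assumes c: "c \<ge> 0" and sc: "s\<^sup>2 + c\<^sup>2 = 1"
  shows "sqrt (54 * (1 + c)) + s * (9/4 + 144/65 * c\<^sup>2) < 9 * sqrt (6/5) + sqrt 91 / 4"
proof -
  have "9859/9000 < sqrt (6/5)" by (rule real_less_rsqrt) (simp add: power2_eq_square)
  moreover have "9536/1000 < sqrt 91" by (rule real_less_rsqrt) (simp add: power2_eq_square)
  ultimately have rhs: "12243/1000 < 9 * sqrt (6/5) + sqrt 91 / 4" by simp
  have "0 \<le> (sqrt (54 * (1 + c)) - 986/100)\<^sup>2" by simp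
  also have "\<dots> = 54 * (1 + c) - 2 * (986/100) * sqrt (54 * (1 + c)) + (986/100)\<^sup>2"
    using c by (simp add: power2_diff)
  finally have 1: "sqrt (54 * (1 + c)) \<le> (54 * (1 + c) / (986/100) + 986/100) / 2"
    unfolding power2_eq_square by argo
  have "0 \<le> (s - 3/5)\<^sup>2" by simp
  then have "s \<le> (34/25 - c\<^sup>2) / (6/5)"
    using sc by (simp add: power2_diff power_divide)
  then have "s * (9/4 + 144/65 * c\<^sup>2) \<le> (34/25 - c\<^sup>2) / (6/5) * (9/4 + 144/65 * c\<^sup>2)"
    by (intro mult_right_mono) auto
  \<comment> \<open>A concave quadratic in \<open>c\<^sup>2\<close>; splitting off the square about
    3/5, near 16/25, leaves a bound linear in \<open>c\<^sup>2\<close>.\<close>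
  also have "\<dots> = 51/20 + 1653/2600 * c\<^sup>2 - 24/13 * (c\<^sup>2 - 3/5)\<^sup>2 - 144/65 * c\<^sup>2 + 216/325"
    by (simp add: power2_eq_square field_simps)
  also have "\<dots> \<le> 51/20 + 216/325 - 4107/2600 * c\<^sup>2"
    by simp
  \<comment> \<open>The tangent point 13/15 makes the slope in \<open>c\<close> almost opposite to
    that of bound \<open>1\<close>. Their sum is nearly constant, and \<open>c \<le> 1\<close>
    controls the tiny remaining slope.\<close>
  also have "\<dots> = 51/20 + 216/325 - 4107/2600 * (c - 13/15)\<^sup>2 - 4107/2600 * (26/15) * c + 4107/2600 * (169/225)"
    by (simp add: power2_eq_square algebra_simps)
  also have "\<dots> \<le> 51/20 + 216/325 - 4107/2600 * (26/15) * c + 4107/2600 * (169/225)"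
    by simp
  finally have 2: "s * (9/4 + 144/65 * c\<^sup>2) \<le> \<dots>" .
  have "c \<le> 1" using sc c by (metis abs_le_square_iff abs_of_nonneg le_add_same_cancel2 one_power2 power2_abs abs_1 zero_le_power2)
  then show ?thesis using 1 2 rhs c by argo
qed

text \<open>AM-GM with weight 9/4, close to the ratio of the factors at the maximum.\<close>
lemma unit_circle_bound:
  fixes c x y :: real
  assumes "x\<^sup>2 + y\<^sup>2 = 1"
  shows "x * (2 * c + y) \<le> 9/8 + 72/65 * c\<^sup>2"
proof -
  have "0 \<le> (9/4 * x - (2 * c + y))\<^sup>2" by simp
  then have "9/2 * (x * (2 * c + y)) \<le> 81/16 * x\<^sup>2 + (2 * c + y)\<^sup>2"
    by (simp add: power2_eq_square algebra_simps)
  also have "\<dots> = 81/16 - 65/16 * (y - 32/65 * c)\<^sup>2 + 4 * (81/65) * c\<^sup>2"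
    using assms by (simp add: power2_eq_square algebra_simps)
  also have "\<dots> \<le> 81/16 + 4 * (81/65) * c\<^sup>2" by simp
  finally show ?thesis by simp
qed

text \<open>Both sides are homogeneous in \<open>u\<close>. The factor collects \<open>l\<close>
  twice for the inner points and \<open>l / 2\<close> for each endpoint.\<close>

lemma cross_path_bound_unit:
  fixes u a x y b :: "real^3"
  assumes "norm a = 1" "norm x = 1" "norm y = 1" "norm b = 1"
  shows "u \<bullet> (a \<times> x + x \<times> y + y \<times> b) \<le> 3 * sqrt 3 / 2 * norm u - u \<bullet> (a \<times> b) / 2"
proof (cases "u = 0")
  case False
  define n where "n = u /\<^sub>R norm u"
  have u: "u = norm u *\<^sub>R n" "norm n = 1" using False by (simp_all add: n_def)
  have "n \<bullet> (a \<times> x + x \<times> y + y \<times> b) \<le> 3 * sqrt 3 / 2 - n \<bullet> (a \<times> b) / 2"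
    using cross_path_bound[OF u(2), of a x y b] assms by (simp add: field_simps)
  then have "norm u * (n \<bullet> (a \<times> x + x \<times> y + y \<times> b)) \<le> norm u * (3 * sqrt 3 / 2 - n \<bullet> (a \<times> b) / 2)"
    by (intro mult_left_mono) auto
  moreover have "u \<bullet> z = norm u * (n \<bullet> z)" for z
    by (subst u(1)) simp
  ultimately show ?thesis by (simp add: algebra_simps)
qed simp

text \<open>The double-angle formula for the sine: the two norms are twice the sine and twice the
  cosine of half the angle between \<open>a\<close> and \<open>b\<close>.\<close>

lemma norm_cross_unit:
  fixes a b :: "real^3"
  assumes "norm a = 1" "norm b = 1"
  shows "norm (a \<times> b) = norm (a - b) * norm (a + b) / 2"
proof -
  have ab: "(norm (a - b))\<^sup>2 = 2 - 2 * (a \<bullet> b)" "(norm (a + b))\<^sup>2 = 2 + 2 * (a \<bullet> b)"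
    using assms
    by (simp_all add: power2_norm_eq_inner inner_diff inner_add inner_commute norm_eq_1)
  have "(norm (a \<times> b))\<^sup>2 = 1 - (a \<bullet> b)\<^sup>2"
    using norm_cross_dot[of a b] assms by simp
  also have "\<dots> = (norm (a - b) * norm (a + b) / 2)\<^sup>2"
    by (simp add: power_mult_distrib power_divide ab) (simp add: power2_eq_square algebra_simps)
  finally have "(norm (a \<times> b))\<^sup>2 = (norm (a - b) * norm (a + b) / 2)\<^sup>2" .
  then show ?thesis by simp
qed

lemma half_sum_diff_unit:
  fixes a b :: "'a::real_inner"
  assumes "norm a = 1" "norm b = 1"
  shows "(norm (a - b) / 2)\<^sup>2 + (norm (a + b) / 2)\<^sup>2 = 1"
  using assms
  by (simp add: power_divide power2_norm_eq_inner inner_diff inner_add inner_commute norm_eq_1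
      flip: add_divide_distrib)

text \<open>This eliminates \<open>p 9\<close>. The sum is at most its quadratic-mean bound, which
  is largest when \<open>c\<close> points opposite to \<open>a + b\<close>.\<close>

lemma norm_diff_sum_unit:
  fixes a b c :: "'a::real_inner"
  assumes "norm a = 1" "norm b = 1" "norm c = 1"
  shows "norm (c - a) + norm (c - b) \<le> sqrt (8 + 4 * norm (a + b))"
proof (rule real_le_rsqrt)
  have "0 \<le> (norm (c - a) - norm (c - b))\<^sup>2" by simp
  then have "(norm (c - a) + norm (c - b))\<^sup>2 \<le> 2 * ((norm (c - a))\<^sup>2 + (norm (c - b))\<^sup>2)"
    by (simp add: power2_eq_square algebra_simps)
  also have "\<dots> = 8 + 4 * (- c \<bullet> (a + b))"
    using assms by (simp add: power2_norm_eq_inner inner_diff inner_add inner_commute norm_eq_1)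
  also have "- c \<bullet> (a + b) \<le> norm (a + b)"
    using norm_cauchy_schwarz[of "-c" "a + b"] assms by simp
  finally show "(norm (c - a) + norm (c - b))\<^sup>2 \<le> 8 + 4 * norm (a + b)" by simp
qed

section \<open>The determinant sum over the facets and its upper bound\<close>

definition "triple a b c = a \<bullet> (b \<times> c)" for a b c :: "real^3"

text \<open>The order inside each triple matters: the two triangles at any edge traverse it in
  opposite directions, so the closed surface is coherently oriented.\<close>

definition split_volume :: "(nat \<Rightarrow> real^3) \<Rightarrow> real" where
  "split_volume p =
     triple (p 9) (p 1) (p 2) + triple (p 9) (p 2) (p 6) + triple (p 9) (p 6) (p 3) +
     triple (p 9) (p 3) (p 4) + triple (p 9) (p 4) (p 5) + triple (p 9) (p 5) (p 1) +
     triple (p 7) (p 3) (p 6) + triple (p 7) (p 4) (p 3) + triple (p 7) (p 5) (p 4) +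
     triple (p 8) (p 1) (p 5) + triple (p 8) (p 2) (p 1) + triple (p 8) (p 6) (p 2) +
     triple (p 7) (p 8) (p 5) + triple (p 7) (p 6) (p 8)"

text \<open>The hexagon 5, 1, 2, 6, 3, 4 is seen as a whole from vertex 9. Its path 5, 1, 2, 6 is
  also seen from 8 and its path 6, 3, 4, 5 from 7, which gives the two differences; the last term is
  the pair of triangles at the edge 78.\<close>

lemma split_volume_eq:
  "split_volume p =
     (p 9 - p 8) \<bullet> (p 5 \<times> p 1 + p 1 \<times> p 2 + p 2 \<times> p 6) +
     (p 9 - p 7) \<bullet> (p 6 \<times> p 3 + p 3 \<times> p 4 + p 4 \<times> p 5) +
     (p 7 \<times> p 8) \<bullet> (p 5 - p 6)"
proof -
  have "triple (p 7) (p 8) (p 5) + triple (p 7) (p 6) (p 8) = (p 7 \<times> p 8) \<bullet> (p 5 - p 6)"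
    by (simp add: triple_def cross3_simps)
  then show ?thesis
    using cross_skew[of "p 3" "p 6"] cross_skew[of "p 4" "p 3"] cross_skew[of "p 5" "p 4"]
      cross_skew[of "p 1" "p 5"] cross_skew[of "p 2" "p 1"] cross_skew[of "p 6" "p 2"]
    by (simp add: split_volume_def triple_def inner_diff_left inner_add_right)
qed

theorem split_volume_less:
  assumes p: "\<And>i. i \<in> {1..9} \<Longrightarrow> norm (p i) = 1"
  shows "split_volume p < 9 * sqrt (6/5) + sqrt 91 / 4"
proof -
  have n: "norm (p 1) = 1" "norm (p 2) = 1" "norm (p 3) = 1" "norm (p 4) = 1" "norm (p 5) = 1"
    "norm (p 6) = 1" "norm (p 7) = 1" "norm (p 8) = 1" "norm (p 9) = 1"
    using p by simp_all
  \<comment> \<open>Cosine and sine of half the angle between \<open>p 7\<close> and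
    \<open>p 8\<close>, then sine and cosine for \<open>p 5\<close> and \<open>p 6\<close>.\<close>
  define c where "c = norm (p 7 + p 8) / 2"
  define s where "s = norm (p 7 - p 8) / 2"
  define x where "x = norm (p 5 - p 6) / 2"
  define y where "y = norm (p 5 + p 6) / 2"
  have c: "c \<ge> 0" and s: "s \<ge> 0" and sc: "s\<^sup>2 + c\<^sup>2 = 1" and xy: "x\<^sup>2 + y\<^sup>2 = 1"
    using half_sum_diff_unit n by (simp_all add: c_def s_def x_def y_def)
  \<comment> \<open>The two paths join \<open>p 5\<close> and \<open>p 6\<close> in opposite
    directions, so \<open>p 9\<close> cancels from the correction terms and only
    \<open>p 8 - p 7\<close> is left there.\<close>
  have "split_volume p \<le> 3 * sqrt 3 / 2 * (norm (p 9 - p 7) + norm (p 9 - p 8))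
     + ((p 8 - p 7) \<bullet> (p 5 \<times> p 6) / 2 + (p 7 \<times> p 8) \<bullet> (p 5 - p 6))"
    using cross_path_bound_unit[OF n(5,1,2,6), of "p 9 - p 8"]
      cross_path_bound_unit[OF n(6,3,4,5), of "p 9 - p 7"]
    unfolding split_volume_eq cross_skew[of "p 6" "p 5"] inner_diff_left inner_minus_right ring_distribs
    by argo
  also have "3 * sqrt 3 / 2 * (norm (p 9 - p 7) + norm (p 9 - p 8))
      \<le> 3 * sqrt 3 / 2 * sqrt (8 + 4 * norm (p 7 + p 8))"
    using norm_diff_sum_unit n by (intro mult_left_mono) auto
  also have "\<dots> = sqrt (27 / 4) * sqrt (8 + 8 * c)"
    using real_sqrt_mult[of 9 3] by (simp add: real_sqrt_divide c_def)
  also have "\<dots> = sqrt (54 * (1 + c))"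
    by (simp flip: real_sqrt_mult)
  also have "(p 8 - p 7) \<bullet> (p 5 \<times> p 6) / 2 + (p 7 \<times> p 8) \<bullet> (p 5 - p 6) \<le> 2 * s * (x * (2 * c + y))"
  proof -
    have "(p 8 - p 7) \<bullet> (p 5 \<times> p 6) \<le> norm (p 8 - p 7) * norm (p 5 \<times> p 6)"
      by (rule norm_cauchy_schwarz)
    also have "\<dots> = 2 * s * (2 * x * y)"
      by (simp add: norm_cross_unit n s_def x_def y_def norm_minus_commute)
    finally have 1: "(p 8 - p 7) \<bullet> (p 5 \<times> p 6) \<le> \<dots>" .
    have "(p 7 \<times> p 8) \<bullet> (p 5 - p 6) \<le> norm (p 7 \<times> p 8) * norm (p 5 - p 6)"
      by (rule norm_cauchy_schwarz)
    also have "\<dots> = 2 * s * c * (2 * x)"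
      by (simp add: norm_cross_unit n s_def x_def c_def)
    finally show ?thesis using 1 by (simp add: algebra_simps) argo
  qed
  also have "2 * s * (x * (2 * c + y)) \<le> 2 * s * (9/8 + 72/65 * c\<^sup>2)"
    using unit_circle_bound[OF xy] s by (intro mult_left_mono) auto
  also have "\<dots> = s * (9/4 + 144/65 * c\<^sup>2)" by (simp add: algebra_simps)
  also have "sqrt (54 * (1 + c)) + s * (9/4 + 144/65 * c\<^sup>2) < 9 * sqrt (6/5) + sqrt 91 / 4"
    by (rule univariate_bound[OF c sc])
  finally show ?thesis by simp
qed

section \<open>Combinatorial equivalence and facets\<close>

lemma combinatorially_equivalent_sym:
  assumes "combinatorially_equivalent P Q"
  shows "combinatorially_equivalent Q P"
proof -
  obtain \<phi> where bij: "bij_betw \<phi> {F. F face_of P} {G. G face_of Q}"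
    and mono: "\<And>F F'. F face_of P \<Longrightarrow> F' face_of P \<Longrightarrow> F \<subseteq> F' \<longleftrightarrow> \<phi> F \<subseteq> \<phi> F'"
    using assms unfolding combinatorially_equivalent_def by blast
  define \<psi> where "\<psi> = inv_into {F. F face_of P} \<phi>"
  have "bij_betw \<psi> {G. G face_of Q} {F. F face_of P}"
    unfolding \<psi>_def by (rule bij_betw_inv_into[OF bij])
  moreover have "\<psi> G face_of P" "\<phi> (\<psi> G) = G" if "G face_of Q" for G
    using that bij_betw_inv_into_right[OF bij, of G] bij_betw_apply[OF calculation, of G]
    by (simp_all add: \<psi>_def)
  ultimately show ?thesis
    unfolding combinatorially_equivalent_def using mono by metis
qed

text \<open>Describes vertices by inclusion alone, so that isomorphisms of face lattices preserve
  them. A nonempty face is a polytope and has an extreme point, whose singleton is again a face of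
  \<open>P\<close>.\<close>

lemma singleton_face_iff_atom:
  fixes P :: "'a::euclidean_space set"
  assumes "polytope P" "F face_of P"
  shows "(\<exists>x. F = {x}) \<longleftrightarrow> F \<noteq> {} \<and> (\<forall>G. G face_of P \<longrightarrow> G \<subseteq> F \<longrightarrow> G = {} \<or> G = F)"
proof
  assume R: "F \<noteq> {} \<and> (\<forall>G. G face_of P \<longrightarrow> G \<subseteq> F \<longrightarrow> G = {} \<or> G = F)"
  have "polytope F" using assms face_of_polytope_polytope by blast
  then have "F = convex hull {x. x extreme_point_of F}"
    by (simp add: Krein_Milman_Minkowski polytope_imp_compact polytope_imp_convex)
  then obtain x where x: "x extreme_point_of F"
    using R by fastforce
  then have "{x} face_of P" "x \<in> F"
    using assms(2) by (simp_all add: extreme_point_of_face face_of_singleton)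
  then show "\<exists>x. F = {x}" using R by blast
qed auto

text \<open>The analogue for facets: dimension grows strictly along proper inclusions of faces, and
  every nonempty proper face lies in a facet. The condition \<open>F \<noteq> {}\<close> matters
  when \<open>P\<close> is a point, since its empty face is a coatom but no facet.\<close>

lemma facet_iff_coatom:
  fixes P :: "'a::euclidean_space set"
  assumes "polytope P" "F face_of P"
  shows "F facet_of P \<longleftrightarrow>
    F \<noteq> {} \<and> F \<noteq> P \<and> (\<forall>G. G face_of P \<longrightarrow> F \<subseteq> G \<longrightarrow> G = F \<or> G = P)"
proof
  assume F: "F facet_of P"
  have "G = F" if G: "G face_of P" "F \<subseteq> G" "G \<noteq> P" for G
  proof (rule ccontr)
    assume "G \<noteq> F"
    have "F face_of G" using assms(2) G face_of_imp_subset face_of_subset by blast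
    then have "aff_dim F < aff_dim G"
      using \<open>G \<noteq> F\<close> G(1) face_of_aff_dim_lt face_of_imp_convex by blast
    moreover have "aff_dim G < aff_dim P"
      using G assms(1) face_of_aff_dim_lt polytope_imp_convex by blast
    ultimately show False using F by (simp add: facet_of_def)
  qed
  then show "F \<noteq> {} \<and> F \<noteq> P \<and> (\<forall>G. G face_of P \<longrightarrow> F \<subseteq> G \<longrightarrow> G = F \<or> G = P)"
    using F facet_of_irrefl by (auto simp: facet_of_def)
next
  assume "F \<noteq> {} \<and> F \<noteq> P \<and> (\<forall>G. G face_of P \<longrightarrow> F \<subseteq> G \<longrightarrow> G = F \<or> G = P)"
  then show "F facet_of P"
    using assms polytope_imp_polyhedron
    by (metis face_of_polyhedron_subset_facet facet_of_imp_face_of facet_of_irrefl)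
qed

text \<open>The isomorphism \<open>\<psi>\<close> permits reading off \<open>g\<close> from the
  atoms. Each face is the hull of the vertices it contains, so \<open>g\<close> determines
  \<open>\<psi>\<close>, and coatoms go to coatoms.\<close>

lemma combinatorially_equivalent_facets:
  fixes P :: "'a::euclidean_space set" and Q :: "'b::euclidean_space set"
  assumes "polytope P" "polytope Q" "combinatorially_equivalent Q P"
  obtains g where "bij_betw g (vertices_of Q) (vertices_of P)"
    "{F. F facet_of P} = (\<lambda>G. convex hull (g ` vertices_of G)) ` {G. G facet_of Q}"
proof -
  obtain \<psi> where bij: "bij_betw \<psi> {F. F face_of Q} {G. G face_of P}"
    and mono: "\<And>F F'. F face_of Q \<Longrightarrow> F' face_of Q \<Longrightarrow> F \<subseteq> F' \<longleftrightarrow> \<psi> F \<subseteq> \<psi> F'"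
    using assms(3) unfolding combinatorially_equivalent_def by blast
  have face: "\<psi> F face_of P" if "F face_of Q" for F
    using bij_betw_apply[OF bij] that by simp
  have ex: "\<exists>F. F face_of Q \<and> G = \<psi> F" if "G face_of P" for G
    using bij_betw_imp_surj_on[OF bij] that by auto
  have eq: "\<psi> F = \<psi> F' \<longleftrightarrow> F = F'" if "F face_of Q" "F' face_of Q" for F F'
    using mono that by blast
  have empty: "\<psi> F = {} \<longleftrightarrow> F = {}" if "F face_of Q" for F
    by (metis ex mono eq empty_face_of empty_subsetI subset_empty that)
  have whole: "\<psi> F = P \<longleftrightarrow> F = Q" if "F face_of Q" for F
    by (metis assms(1,2) eq ex face face_of_imp_subset face_of_refl mono polytope_imp_convex
        subset_antisym that)
  \<comment> \<open>Moves quantification over faces of \<open>P\<close> to faces of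
    \<open>Q\<close>, so that the order-theoretic descriptions of atoms and coatoms transfer by
    rewriting.\<close>
  have all: "(\<forall>G. G face_of P \<longrightarrow> R G) \<longleftrightarrow> (\<forall>F. F face_of Q \<longrightarrow> R (\<psi> F))" for R
    using ex face by blast
  have atom: "(\<exists>y. \<psi> F = {y}) \<longleftrightarrow> (\<exists>x. F = {x})" if "F face_of Q" for F
    unfolding singleton_face_iff_atom[OF assms(1) face[OF that]]
      singleton_face_iff_atom[OF assms(2) that] all
    using that by (simp add: empty eq flip: mono)
  have coatom: "\<psi> F facet_of P \<longleftrightarrow> F facet_of Q" if "F face_of Q" for F
    unfolding facet_iff_coatom[OF assms(1) face[OF that]]
      facet_iff_coatom[OF assms(2) that] all
    using that by (simp add: empty whole eq flip: mono)
  have vQ: "{x} face_of Q" if "x \<in> vertices_of Q" for x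
    using that by (simp add: vertices_of_def face_of_singleton)
  define g where "g x = the_elem (\<psi> {x})" for x
  have g: "\<psi> {x} = {g x}" if x: "x \<in> vertices_of Q" for x
  proof -
    obtain y where "\<psi> {x} = {y}" using atom[OF vQ[OF x]] by blast
    then show ?thesis by (simp add: g_def)
  qed
  have gP: "g x \<in> vertices_of P" if "x \<in> vertices_of Q" for x
    using face[OF vQ[OF that]] g[OF that] by (simp add: vertices_of_def face_of_singleton)
  have surj: "\<exists>x\<in>vertices_of Q. y = g x" if "y \<in> vertices_of P" for y
  proof -
    have "{y} face_of P" using that by (simp add: vertices_of_def face_of_singleton)
    then obtain F where F: "F face_of Q" "{y} = \<psi> F" using ex by blast
    then obtain x where "F = {x}" using atom by metis
    then show ?thesis using F g[of x] by (auto simp: vertices_of_def face_of_singleton)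
  qed
  have im: "g ` vertices_of Q = vertices_of P"
    using gP surj by blast
  moreover have "inj_on g (vertices_of Q)"
    by (rule inj_onI) (metis g vQ eq singleton_inject)
  ultimately have bij_g: "bij_betw g (vertices_of Q) (vertices_of P)"
    by (simp add: bij_betw_def)
  have hull: "\<psi> G = convex hull (g ` vertices_of G)" if G: "G face_of Q" for G
  proof -
    have "polytope (\<psi> G)" using face[OF G] assms(1) face_of_polytope_polytope by blast
    then have "\<psi> G = convex hull {y. y extreme_point_of \<psi> G}"
      by (simp add: Krein_Milman_Minkowski polytope_imp_compact polytope_imp_convex)
    also have "{y. y extreme_point_of \<psi> G} = {y \<in> vertices_of P. {y} \<subseteq> \<psi> G}"
      using extreme_point_of_face[OF face[OF G]] by (auto simp: vertices_of_def)
    also have "\<dots> = g ` {x \<in> vertices_of Q. \<psi> {x} \<subseteq> \<psi> G}"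
      unfolding im[symmetric] using g by auto
    also have "{x \<in> vertices_of Q. \<psi> {x} \<subseteq> \<psi> G} = {x \<in> vertices_of Q. {x} \<subseteq> G}"
      by (intro Collect_cong conj_cong refl) (simp only: mono[OF vQ G])
    also have "{x \<in> vertices_of Q. {x} \<subseteq> G} = vertices_of G"
      using extreme_point_of_face[OF G] by (auto simp: vertices_of_def)
    finally show ?thesis .
  qed
  have "F facet_of P \<longleftrightarrow> (\<exists>G. G facet_of Q \<and> F = \<psi> G)" for F
    by (metis coatom ex facet_of_imp_face_of)
  then have "{F. F facet_of P} = \<psi> ` {G. G facet_of Q}"
    by auto
  also have "\<dots> = (\<lambda>G. convex hull (g ` vertices_of G)) ` {G. G facet_of Q}"
    by (intro image_cong refl) (simp add: hull facet_of_imp_face_of)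
  finally show thesis
    using bij_g by (intro that)
qed

lemma apex_split_triangles_subset: "t \<in> apex_split_triangles \<Longrightarrow> t \<subseteq> {1..9}"
  by (auto simp: apex_split_triangles_def)

text \<open>\<open>class_A\<close> fixes the type only through a model \<open>Q\<close>; this labels
  the vertices of \<open>P\<close> itself, which are the points on the sphere.\<close>

lemma apex_split_hexagonal_bipyramid_combinatorial:
  fixes P :: "(real^3) set"
  assumes P: "polytope P" and Q: "apex_split_hexagonal_bipyramid Q"
    and PQ: "combinatorially_equivalent P Q"
  shows "apex_split_hexagonal_bipyramid P"
proof -
  obtain q where q: "bij_betw q {1..9} (vertices_of Q)"
    and Qf: "{F. F facet_of Q} = (\<lambda>t. convex hull (q ` t)) ` apex_split_triangles"
    and "polytope Q"
    using Q unfolding apex_split_hexagonal_bipyramid_def by blast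
  obtain g where g: "bij_betw g (vertices_of Q) (vertices_of P)"
    and gf: "{F. F facet_of P} = (\<lambda>G. convex hull (g ` vertices_of G)) ` {G. G facet_of Q}"
    using combinatorially_equivalent_facets[OF P \<open>polytope Q\<close> combinatorially_equivalent_sym[OF PQ]]
    by blast
  \<comment> \<open>Extreme points of a hull are among its generators; conversely, a vertex of
    \<open>Q\<close> lying in a face is extreme in that face.\<close>
  have "vertices_of (convex hull (q ` t)) = q ` t" if t: "t \<in> apex_split_triangles" for t
  proof -
    have face: "(convex hull (q ` t)) face_of Q" using Qf t facet_of_imp_face_of by blast
    have "q ` t \<subseteq> vertices_of Q"
      using apex_split_triangles_subset[OF t] bij_betw_imp_surj_on[OF q] by blast
    then show ?thesis
      using extreme_point_of_face[OF face] extreme_point_of_convex_hull[of _ "q ` t"]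
        hull_inc[of _ "q ` t" convex]
      unfolding vertices_of_def by blast
  qed
  then have "{F. F facet_of P} = (\<lambda>t. convex hull ((g \<circ> q) ` t)) ` apex_split_triangles"
    unfolding gf Qf image_image by (intro image_cong) (simp_all add: image_image)
  moreover have "bij_betw (g \<circ> q) {1..9} (vertices_of P)"
    using q g by (rule bij_betw_trans)
  ultimately show ?thesis
    using P unfolding apex_split_hexagonal_bipyramid_def by blast
qed

section \<open>Volume and orientation\<close>

text \<open>The ray from \<open>z\<close> through \<open>x\<close> leaves \<open>P\<close> at a
  point of the relative frontier, which is the union of the facets.\<close>

lemma polytope_subset_Union_cones:
  fixes P :: "'a::euclidean_space set"
  assumes "polytope P" "z \<in> interior P"
  shows "P \<subseteq> (\<Union>F\<in>{F. F facet_of P}. convex hull (insert z F))"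
proof
  fix x assume "x \<in> P"
  have "z \<in> rel_interior P" using assms(2) interior_subset_rel_interior by blast
  moreover have "\<not> (z = x \<and> P = {z})" using assms(2) by auto
  ultimately obtain y where y: "y \<in> rel_frontier P" "x \<in> closed_segment z y"
    using segment_to_rel_frontier \<open>x \<in> P\<close> assms(1) polytope_imp_bounded polytope_imp_convex by metis
  then obtain F where F: "F facet_of P" "y \<in> F"
    using rel_frontier_of_polyhedron[OF polytope_imp_polyhedron[OF assms(1)]] by auto
  then have "convex hull {z, y} \<subseteq> convex hull (insert z F)" by (intro hull_mono) auto
  then show "x \<in> (\<Union>F\<in>{F. F facet_of P}. convex hull (insert z F))"
    using y F by (auto simp: segment_convex_hull)
qed

text \<open>A nonzero determinant forces the four points to be distinct, so \<open>f\<close> indexes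
  the three other than \<open>z\<close> bijectively, as \<open>content_simplex\<close>
  requires.\<close>

lemma measure_tetrahedron:
  fixes a b c z :: "real^3"
  assumes "triple (a - z) (b - z) (c - z) \<noteq> 0"
  shows "measure lebesgue (convex hull {z, a, b, c}) = \<bar>triple (a - z) (b - z) (c - z)\<bar> / 6"
proof -
  define f where "f i = (if i = 1 then a else if i = 2 then b else c)" for i :: 3
  have dist: "z \<noteq> a" "z \<noteq> b" "z \<noteq> c" "a \<noteq> b" "a \<noteq> c" "b \<noteq> c"
    using assms by (auto simp: triple_def dot_cross_self)
  have f: "f 1 = a" "f 2 = b" "f 3 = c" by (simp_all add: f_def)
  have "inj_on f {1, 2, 3}" using dist f by (simp add: eq_commute)
  moreover have "f ` {1, 2, 3} = {z, a, b, c} - {z}" using dist f by auto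
  ultimately have "bij_betw f UNIV ({z, a, b, c} - {z})"
    by (simp only: bij_betw_def UNIV_3)
  then have "measure lborel (convex hull {z, a, b, c}) = \<bar>det (\<chi> i j. f j $ i - z $ i)\<bar> / fact CARD(3)"
    using dist by (intro content_simplex) auto
  also have "det (\<chi> i j. f j $ i - z $ i) = triple (a - z) (b - z) (c - z)"
    by (simp add: det_3 f triple_def cross3_simps)
  finally show ?thesis
    by (simp add: measure_completion borel_compact finite_imp_compact_convex_hull fact_numeral)
qed

text \<open>The facet spans a supporting plane, whose normal \<open>n\<close> is parallel to
  \<open>w\<close>. Hence \<open>w \<bullet> (z - a)\<close> has constant sign for \<open>z\<close>
  in \<open>P\<close> off the facet.\<close>

lemma same_side_of_facet:
  fixes P :: "(real^3) set"
  assumes P: "polytope P" "interior P \<noteq> {}" and F: "(convex hull {a, b, c}) facet_of P"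
    and x: "x \<in> P" "x \<notin> convex hull {a, b, c}" and y: "y \<in> P" "y \<notin> convex hull {a, b, c}"
  shows "triple (b - a) (c - a) (x - a) * triple (b - a) (c - a) (y - a) > 0"
proof -
  define w where "w = (b - a) \<times> (c - a)"
  obtain n \<beta> where n: "n \<noteq> 0" "P \<subseteq> {x. n \<bullet> x \<le> \<beta>}"
    and Fn: "convex hull {a, b, c} = P \<inter> {x. n \<bullet> x = \<beta>}"
    using facet_of_polyhedron[OF polytope_imp_polyhedron[OF P(1)] F] by blast
  have abc: "n \<bullet> a = \<beta>" "n \<bullet> b = \<beta>" "n \<bullet> c = \<beta>"
    using Fn hull_subset[of "{a, b, c}" convex] by auto
  have "aff_dim (convex hull {a, b, c}) = 2"
    using F P(2) by (simp add: facet_of_def aff_dim_nonempty_interior)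
  then have "\<not> collinear {a, b, c}"
    by (simp add: collinear_aff_dim aff_dim_convex_hull)
  then have "w \<noteq> 0"
    using collinear_3[of b a c] by (simp add: w_def cross_eq_0 insert_commute)
  have "n \<times> w = 0"
    unfolding w_def Lagrange using abc by (simp add: inner_diff_right)
  then have "(w \<bullet> w) *\<^sub>R n = (w \<bullet> n) *\<^sub>R w"
    using Lagrange[of w n w] by simp
  then have nw: "(w \<bullet> w) * (n \<bullet> z) = (w \<bullet> n) * (w \<bullet> z)" for z
    by (metis inner_scaleR_left)
  have "(w \<bullet> n) * (w \<bullet> (z - a)) < 0" if "z \<in> P" "z \<notin> convex hull {a, b, c}" for z
  proof -
    have "n \<bullet> (z - a) < 0" using that n(2) Fn abc by (force simp: inner_diff_right)
    then show ?thesis using \<open>w \<noteq> 0\<close> by (simp add: mult_pos_neg flip: nw)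
  qed
  \<comment> \<open>The sign of \<open>w \<bullet> n\<close> is unknown, but the product over both
    points contains it only as a square.\<close>
  then have "((w \<bullet> n) * (w \<bullet> (x - a))) * ((w \<bullet> n) * (w \<bullet> (y - a))) > 0"
    using x y by (intro mult_neg_neg)
  then have "(w \<bullet> n)\<^sup>2 * ((w \<bullet> (x - a)) * (w \<bullet> (y - a))) > 0"
    by (simp add: power2_eq_square algebra_simps)
  then have "(w \<bullet> (x - a)) * (w \<bullet> (y - a)) > 0"
    by (metis zero_le_power2 zero_less_mult_iff not_less)
  moreover have "triple (b - a) (c - a) z = w \<bullet> z" for z
    by (simp add: triple_def w_def cross3_simps)
  ultimately show ?thesis by simp
qed

text \<open>The point \<open>z\<close> lies on the same side of \<open>abc\<close> as \<open>d\<close>, and on the same side of \<open>bad\<close> as \<open>c\<close>;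
  \<open>(a, b, c, d)\<close> and \<open>(b, a, d, c)\<close> differ by an even permutation.\<close>
lemma adjacent_facets_orientation:
  fixes P :: "(real^3) set"
  assumes P: "polytope P" and z: "z \<in> interior P"
    and F: "(convex hull {a, b, c}) facet_of P" "(convex hull {b, a, d}) facet_of P"
    and c: "c \<notin> convex hull {b, a, d}" and d: "d \<notin> convex hull {a, b, c}"
  shows "triple (a - z) (b - z) (c - z) * triple (b - z) (a - z) (d - z) > 0"
proof -
  have z': "z \<in> P" "z \<notin> convex hull {a, b, c}" "z \<notin> convex hull {b, a, d}"
    using F z interior_subset face_of_disjoint_interior facet_of_imp_face_of facet_of_irrefl
    by blast+
  have "c \<in> P" "d \<in> P"
    using F[THEN facet_of_imp_subset] hull_inc[of c "{a, b, c}" convex] hull_inc[of d "{b, a, d}" convex]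
    by auto
  then have "triple (b - a) (c - a) (z - a) * triple (b - a) (c - a) (d - a) > 0"
    "triple (a - b) (d - b) (z - b) * triple (a - b) (d - b) (c - b) > 0"
    using same_side_of_facet[OF P _ F(1), of z d] same_side_of_facet[OF P _ F(2), of z c] z z' c d
    by auto
  moreover have "triple (b - a) (c - a) (z - a) = - triple (a - z) (b - z) (c - z)"
    "triple (a - b) (d - b) (z - b) = - triple (b - z) (a - z) (d - z)"
    "triple (a - b) (d - b) (c - b) = triple (b - a) (c - a) (d - a)"
    by (simp_all add: triple_def cross3_simps)
  ultimately show ?thesis
    by (auto simp: zero_less_mult_iff mult_less_0_iff)
qed

lemma measure_polytope_le_cones:
  fixes P :: "'a::euclidean_space set"
  assumes "polytope P" "z \<in> interior P" "finite T" "\<And>t. t \<in> T \<Longrightarrow> finite (S t)"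
    and facets: "{F. F facet_of P} = (\<lambda>t. convex hull S t) ` T"
  shows "measure lebesgue P \<le> (\<Sum>t\<in>T. measure lebesgue (convex hull (insert z (S t))))"
proof -
  have lm: "convex hull (insert z (S t)) \<in> lmeasurable" if "t \<in> T" for t
    using assms that by (simp add: lmeasurable_compact finite_imp_compact_convex_hull)
  have "P \<subseteq> (\<Union>t\<in>T. convex hull (insert z (S t)))"
    using polytope_subset_Union_cones[OF assms(1,2)] unfolding facets by (simp flip: hull_insert)
  then have "measure lebesgue P \<le> measure lebesgue (\<Union>t\<in>T. convex hull (insert z (S t)))"
    using assms lm by (intro measure_mono_fmeasurable fmeasurable.finite_UN)
      (auto simp: polytope_imp_compact lmeasurable_compact fmeasurableD)
  also have "\<dots> \<le> (\<Sum>t\<in>T. measure lebesgue (convex hull (insert z (S t))))"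
    using assms lm by (intro measure_UNION_le) (auto simp: fmeasurableD)
  finally show ?thesis .
qed

text \<open>Expanding each determinant leaves one term linear in \<open>z\<close> per directed edge.
  On a coherently oriented closed surface these cancel in pairs, over the 21 edges listed in the
  proof.\<close>

lemma split_volume_translation: "split_volume (\<lambda>i. p i - z) = split_volume p"
proof -
  define e where "e i j = z \<bullet> (p i \<times> p j)" for i j
  have tr: "triple (p i - z) (p j - z) (p k - z) = triple (p i) (p j) (p k) - e i j - e j k - e k i"
    for i j k
    by (simp add: e_def triple_def cross3_simps)
  have skew: "e j i = - e i j" for i j
    by (simp add: e_def cross_skew[of "p j"])
  show ?thesis
    unfolding split_volume_def tr
    using skew[of 1 2] skew[of 1 5] skew[of 1 8] skew[of 1 9] skew[of 2 6] skew[of 2 8] skew[of 2 9]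
      skew[of 3 4] skew[of 3 6] skew[of 3 7] skew[of 3 9] skew[of 4 5] skew[of 4 7] skew[of 4 9]
      skew[of 5 7] skew[of 5 8] skew[of 5 9] skew[of 6 7] skew[of 6 8] skew[of 6 9] skew[of 7 8]
    by linarith
qed

lemma split_volume_minus: "split_volume (\<lambda>i. - p i) = - split_volume p"
  by (simp add: split_volume_def triple_def)

text \<open>Crossing an edge preserves the sign of the determinant based at \<open>z\<close>, and
  every triangle can be reached from the first. All cone volumes thus carry one sign
  \<open>\<sigma>\<close> and add up to the determinant sum.\<close>

lemma apex_split_volume_le:
  fixes P :: "(real^3) set"
  assumes P: "polytope P" and z: "z \<in> interior P" and inj: "inj_on p {1..9}"
    and ext: "\<And>i. i \<in> {1..9} \<Longrightarrow> p i extreme_point_of P"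
    and facets: "{F. F facet_of P} = (\<lambda>t. convex hull (p ` t)) ` apex_split_triangles"
  shows "6 * measure lebesgue P \<le> \<bar>split_volume p\<bar>"
proof -
  define D where "D i j k = triple (p i - z) (p j - z) (p k - z)" for i j k
  \<comment> \<open>Ordered triples retain the orientation that the sets in
    \<open>apex_split_triangles\<close> forget.\<close>
  define T :: "(nat \<times> nat \<times> nat) set" where
    "T = {(9,1,2), (9,2,6), (9,6,3), (9,3,4), (9,4,5), (9,5,1),
      (7,3,6), (7,4,3), (7,5,4), (8,1,5), (8,2,1), (8,6,2), (7,8,5), (7,6,8)}"
  have T: "apex_split_triangles = (\<lambda>(i, j, k). {i, j, k}) ` T"
    by (simp add: apex_split_triangles_def T_def)
  have facet: "(convex hull (p ` t)) facet_of P" if "t \<in> apex_split_triangles" for t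
    using facets that by blast
  have out: "p l \<notin> convex hull (p ` t)" if "t \<in> apex_split_triangles" "l \<in> {1..9}" "l \<notin> t" for l t
  proof
    assume "p l \<in> convex hull (p ` t)"
    moreover have "(convex hull (p ` t)) face_of P"
      using facet that facet_of_imp_face_of by blast
    ultimately have "p l extreme_point_of (convex hull (p ` t))"
      using ext that by (simp add: extreme_point_of_face)
    then have "p l \<in> p ` t" by (rule extreme_point_of_convex_hull)
    then show False
      using inj_on_image_mem_iff[OF inj that(2) apex_split_triangles_subset[OF that(1)]] that(3)
      by blast
  qed
  have adj: "sgn (D i j k) = sgn (D j i l) \<and> D j i l \<noteq> 0"
    if t: "{i, j, k} \<in> apex_split_triangles" "{j, i, l} \<in> apex_split_triangles"
      and kl: "k \<notin> {j, i, l}" "l \<notin> {i, j, k}" for i j k l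
  proof -
    have "D i j k * D j i l > 0"
      unfolding D_def
    proof (rule adjacent_facets_orientation[OF P z])
      show "(convex hull {p i, p j, p k}) facet_of P" "(convex hull {p j, p i, p l}) facet_of P"
        using t[THEN facet] by simp_all
      show "p k \<notin> convex hull {p j, p i, p l}" "p l \<notin> convex hull {p i, p j, p k}"
        using out[OF t(2), of k] out[OF t(1), of l] t[THEN apex_split_triangles_subset] kl by simp_all
    qed
    then show ?thesis by (auto simp: zero_less_mult_iff)
  qed
  have cyc: "D i j k = D j k i" for i j k
    by (simp add: D_def triple_def cross3_simps)
  define \<sigma> where "\<sigma> = sgn (D 9 1 2)"
  have adj2: "{i, j, k} \<in> apex_split_triangles \<Longrightarrow> {j, i, l} \<in> apex_split_triangles \<Longrightarrow>
      k \<notin> {j, i, l} \<Longrightarrow> l \<notin> {i, j, k} \<Longrightarrow> sgn (D i j k) = \<sigma> \<Longrightarrow> sgn (D j i l) = \<sigma>" for i j k l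
    using adj by metis
  \<comment> \<open>The walk goes round vertex 9, then across the hexagon edges to the triangles at
    7 and 8, and last to the two triangles at the edge 78. Each step crosses the edge given by the
    first two indices, with \<open>cyc\<close> rotating it into place.\<close>
  have s1: "sgn (D 9 1 2) = \<sigma>" by (simp add: \<sigma>_def)
  have s2: "sgn (D 9 2 6) = \<sigma>"
    by (rule adj2[of 2 9 1]) (use s1 cyc[of 2 9 1] in \<open>simp_all add: apex_split_triangles_def insert_commute\<close>)
  have s3: "sgn (D 9 6 3) = \<sigma>"
    by (rule adj2[of 6 9 2]) (use s2 cyc[of 6 9 2] in \<open>simp_all add: apex_split_triangles_def insert_commute\<close>)
  have s4: "sgn (D 9 3 4) = \<sigma>"
    by (rule adj2[of 3 9 6]) (use s3 cyc[of 3 9 6] in \<open>simp_all add: apex_split_triangles_def insert_commute\<close>)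
  have s5: "sgn (D 9 4 5) = \<sigma>"
    by (rule adj2[of 4 9 3]) (use s4 cyc[of 4 9 3] in \<open>simp_all add: apex_split_triangles_def insert_commute\<close>)
  have s6: "sgn (D 9 5 1) = \<sigma>"
    by (rule adj2[of 5 9 4]) (use s5 cyc[of 5 9 4] in \<open>simp_all add: apex_split_triangles_def insert_commute\<close>)
  have s7: "sgn (D 3 6 7) = \<sigma>"
    by (rule adj2[of 6 3 9]) (use s3 cyc[of 9 6 3] in \<open>simp_all add: apex_split_triangles_def insert_commute\<close>)
  have s8: "sgn (D 4 3 7) = \<sigma>"
    by (rule adj2[of 3 4 9]) (use s4 cyc[of 9 3 4] in \<open>simp_all add: apex_split_triangles_def insert_commute\<close>)
  have s9: "sgn (D 5 4 7) = \<sigma>"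
    by (rule adj2[of 4 5 9]) (use s5 cyc[of 9 4 5] in \<open>simp_all add: apex_split_triangles_def insert_commute\<close>)
  have s10: "sgn (D 1 5 8) = \<sigma>"
    by (rule adj2[of 5 1 9]) (use s6 cyc[of 9 5 1] in \<open>simp_all add: apex_split_triangles_def insert_commute\<close>)
  have s11: "sgn (D 2 1 8) = \<sigma>"
    by (rule adj2[of 1 2 9]) (use s1 cyc[of 9 1 2] in \<open>simp_all add: apex_split_triangles_def insert_commute\<close>)
  have s12: "sgn (D 6 2 8) = \<sigma>"
    by (rule adj2[of 2 6 9]) (use s2 cyc[of 9 2 6] in \<open>simp_all add: apex_split_triangles_def insert_commute\<close>)
  have s13: "sgn (D 5 7 8) = \<sigma>"
    by (rule adj2[of 7 5 4]) (use s9 cyc[of 7 5 4] in \<open>simp_all add: apex_split_triangles_def insert_commute\<close>)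
  have s14: "sgn (D 7 6 8) = \<sigma>"
    by (rule adj2[of 6 7 3]) (use s7 cyc[of 3 6 7] in \<open>simp_all add: apex_split_triangles_def insert_commute\<close>)
  have "sgn (D 9 1 2) = sgn (D 1 9 5) \<and> D 1 9 5 \<noteq> 0"
    using adj[of 9 1 2 5] by (simp add: apex_split_triangles_def insert_commute)
  then have \<sigma>: "\<sigma> \<noteq> 0" "\<bar>\<sigma>\<bar> = 1"
    by (auto simp: \<sigma>_def sgn_if)
  have "\<forall>(i, j, k)\<in>T. sgn (D i j k) = \<sigma>"
    by (simp add: T_def cyc[of 7 3 6] cyc[of 7 4 3] cyc[of 7 5 4] cyc[of 8 1 5] cyc[of 8 2 1]
        cyc[of 8 6 2] cyc[of 7 8 5] cyc[of 8 5 7] s1 s2 s3 s4 s5 s6 s7 s8 s9 s10 s11 s12 s13 s14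
        del: One_nat_def)
  then have signs: "sgn (D i j k) = \<sigma>" if "(i, j, k) \<in> T" for i j k
    using that by blast
  have simplex: "measure lebesgue (convex hull {z, p i, p j, p k}) = \<sigma> * D i j k / 6"
    if "(i, j, k) \<in> T" for i j k
  proof -
    have "D i j k \<noteq> 0" using signs[OF that] \<sigma> by auto
    then have "measure lebesgue (convex hull {z, p i, p j, p k}) = \<bar>D i j k\<bar> / 6"
      unfolding D_def by (rule measure_tetrahedron)
    then show ?thesis using signs[OF that] by (simp add: abs_sgn mult.commute)
  qed
  have "measure lebesgue P \<le> (\<Sum>t\<in>T. measure lebesgue (convex hull (insert z (p ` (case t of (i, j, k) \<Rightarrow> {i, j, k})))))"
    using P z by (intro measure_polytope_le_cones) (auto simp: T_def facets T image_image)
  also have "\<dots> = (\<Sum>(i, j, k)\<in>T. \<sigma> * D i j k / 6)"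
    using simplex by (intro sum.cong) auto
  also have "\<dots> = \<sigma> * split_volume (\<lambda>i. p i - z) / 6"
    by (simp add: T_def split_volume_def D_def algebra_simps)
  finally have "6 * measure lebesgue P \<le> \<sigma> * split_volume p"
    by (simp add: split_volume_translation)
  also have "\<dots> \<le> \<bar>split_volume p\<bar>"
    using abs_ge_self[of "\<sigma> * split_volume p"] \<sigma> by (simp add: abs_mult)
  finally show ?thesis .
qed

theorem theorem4p6:
  fixes P :: "(real^3) set"
  assumes "P \<in> class_A"
  shows "6 * measure lebesgue P < 9 * sqrt (6/5) + sqrt 91 / 4"
proof (cases "interior P = {}")
  case True
  have "convex P" using assms by (simp add: class_A_def polytope_imp_convex)
  then have "measure lebesgue P = 0"
    using True negligible_convex_interior negligible_imp_measure0 by blast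
  then show ?thesis by (simp add: add_pos_pos)
next
  case False
  then obtain z where z: "z \<in> interior P" by blast
  have P: "polytope P" and sphere: "vertices_of P \<subseteq> sphere 0 1"
    using assms by (auto simp: class_A_def)
  have "apex_split_hexagonal_bipyramid P"
    using assms apex_split_hexagonal_bipyramid_combinatorial by (auto simp: class_A_def)
  then obtain p where p: "bij_betw p {1..9} (vertices_of P)"
    and facets: "{F. F facet_of P} = (\<lambda>t. convex hull (p ` t)) ` apex_split_triangles"
    unfolding apex_split_hexagonal_bipyramid_def by blast
  have vert: "p i \<in> vertices_of P" if "i \<in> {1..9}" for i
    using p that by (rule bij_betw_apply)
  have "norm (p i) = 1" if "i \<in> {1..9}" for i
    using vert[OF that] sphere by auto
  \<comment> \<open>The orientation of the labelling is unknown, so the bound is also applied to the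
    antipodal points, which negates the sum.\<close>
  then have "split_volume p < 9 * sqrt (6/5) + sqrt 91 / 4"
    "- split_volume p < 9 * sqrt (6/5) + sqrt 91 / 4"
    using split_volume_less[of p] split_volume_less[of "\<lambda>i. - p i"]
    by (simp_all add: split_volume_minus)
  moreover have "6 * measure lebesgue P \<le> \<bar>split_volume p\<bar>"
    using P z bij_betw_imp_inj_on[OF p] vert facets
    by (intro apex_split_volume_le) (auto simp: vertices_of_def)
  ultimately show ?thesis by linarith
qed

end
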